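(* Let $\mathcal{D}$ be a dyadic lattice in $\mathbb{R}^d$, let $E\subset\mathbb{R}^d$ be a nonempty set and let $\gamma>0$. The following properties are equivalent. (i) The set $E$ is porous. (ii) The family $\mathcal{D}_{\gamma,E}$ satisfies the Carleson packing condition. (iii) The family $\mathcal{D}_{\gamma,E}$ is well-sparse with respect to $E$.
   Context: $|A|$ denotes $d$-dimensional Lebesgue measure of $A$. Distances are taken in the $l_\infty$-metric: $\mathrm{dist}(F,E)=\inf_{x\in F,\,y\in E}\max_{1\le i\le d}|x_i-y_i|$. A cube is a half-open set $Q=[a_1,b_1)\times\dots\times[a_d,b_d)$ with equal side lengths $\ell(Q)=b_1-a_1=\dots=b_d-a_d>0$. For a cube $R$, $\mathcal{D}(R)=\bigcup_{j\ge0}\mathcal{D}_j(R)$, where $\mathcal{D}_j(R)$ is the collection of the $2^{jd}$ pairwise disjoint half-open cubes of side length $2^{-j}\ell(R)$ whose union is $R$. A dyadic lattice $\mathcal{D}$ is a collection of cubes such that: (DL1) if $Q\in\mathcal{D}$ then $\mathcal{D}(Q)\subset\mathcal{D}$; (DL2) any two cubes $Q',Q''\in\mathcal{D}$ have a common ancestor, i.e. there is $Q\in\mathcal{D}$ with $Q',Q''\in\mathcal{D}(Q)$; (DL3) for every compact $K\subset\mathbb{R}^d$ there is a cube $Q\in\mathcal{D}$ containing $K$. $\mathcal{D}_{\gamma,E}=\{Q\in\mathcal{D}:\mathrm{dist}(Q,E)<\gamma\,\ell(Q)\}$. A collection $\mathcal{S}\subset\mathcal{D}$ satisfies the Carleson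 packing condition if there is a constant $\xi>0$ such that $\sum_{Q\in\mathcal{S},\,Q\subset R}|Q|\le\xi|R|$ for each cube $R\in\mathcal{D}$. A cube $Q'\in\mathcal{D}$ is called free if $Q'\cap E=\varnothing$. A nonempty set $E\subset\mathbb{R}^d$ is porous (with respect to $\mathcal{D}$) if there is a constant $\eta>1$ such that for each $R\in\mathcal{D}$ there is a free cube $M(R)\in\mathcal{D}$, $M(R)\subset R$, with $\eta|M(R)|\ge|R|$. A collection $\mathcal{S}\subset\mathcal{D}$ is well-sparse with respect to $E$ if there exist a constant $\lambda>1$ and a family of cubes $M(Q)\subset Q$, $Q\in\mathcal{S}$, such that $M(Q')\cap M(Q'')=\varnothing$ for $Q'\ne Q''$, $\lambda|M(Q)|\ge|Q|$ and $M(Q)\cap E=\varnothing$ for each $Q\in\mathcal{S}$. *)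

theory Defs
  imports "HOL-Analysis.Analysis"
begin

definition hcube :: "real ^ 'n \<Rightarrow> real \<Rightarrow> (real ^ 'n) set" where
  "hcube a l = {x. \<forall>i. a $ i \<le> x $ i \<and> x $ i < a $ i + l}"

definition is_cube :: "(real ^ 'n) set \<Rightarrow> bool" where
  "is_cube Q \<longleftrightarrow> (\<exists>a l. 0 < l \<and> Q = hcube a l)"

definition side :: "(real ^ 'n) set \<Rightarrow> real" where
  "side Q = (THE l. 0 < l \<and> (\<exists>a. Q = hcube a l))"

text \<open>The \<open>2\<^sup>j\<^sup>d\<close> subcubes of generation \<open>j\<close> are given by their lower corners, on a grid of mesh
  \<open>l / 2^j\<close>. The corner \<open>a\<close> and side \<open>l\<close> of \<open>R\<close> are uniquely determined by \<open>R\<close>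
  (\<open>hcube_eq_iff\<close>); that these are pairwise disjoint cubes of side \<open>l / 2^j\<close>, \<open>2\<^sup>j\<^sup>d\<close> in number,
  with union \<open>R\<close> is proved in \<open>disjoint_dyadic_gen\<close>, \<open>side_dyadic_gen\<close>, \<open>card_dyadic_gen\<close>,
  \<open>Union_dyadic_gen\<close>.\<close>

definition dyadic_gen :: "nat \<Rightarrow> (real ^ 'n) set \<Rightarrow> (real ^ 'n) set set" where
  "dyadic_gen j R =
     {hcube (\<chi> i. a $ i + real (k i) * (l / 2 ^ j)) (l / 2 ^ j) | a l k.
        0 < l \<and> R = hcube a l \<and> (\<forall>i. k i < 2 ^ j)}"

definition dyadic_subcubes :: "(real ^ 'n) set \<Rightarrow> (real ^ 'n) set set" where
  "dyadic_subcubes R = (\<Union>j. dyadic_gen j R)"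

definition dyadic_lattice :: "(real ^ 'n) set set \<Rightarrow> bool" where
  "dyadic_lattice D \<longleftrightarrow>
     (\<forall>Q\<in>D. is_cube Q) \<and>
     (\<forall>Q\<in>D. dyadic_subcubes Q \<subseteq> D) \<and>
     (\<forall>Q'\<in>D. \<forall>Q''\<in>D. \<exists>Q\<in>D. Q' \<in> dyadic_subcubes Q \<and> Q'' \<in> dyadic_subcubes Q) \<and>
     (\<forall>K. compact K \<longrightarrow> (\<exists>Q\<in>D. K \<subseteq> Q))"

text \<open>Distances are taken in the maximum norm, so the Euclidean \<open>setdist\<close> does not apply.\<close>

definition linf_dist :: "(real ^ 'n) set \<Rightarrow> (real ^ 'n) set \<Rightarrow> real" where
  "linf_dist F E = Inf {infnorm (x - y) | x y. x \<in> F \<and> y \<in> E}"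

definition near_cubes :: "(real ^ 'n) set set \<Rightarrow> real \<Rightarrow> (real ^ 'n) set \<Rightarrow> (real ^ 'n) set set" where
  "near_cubes D \<gamma> E = {Q \<in> D. linf_dist Q E < \<gamma> * side Q}"

text \<open>The sum is taken in the extended nonnegative reals, so that it has its usual meaning, a
  supremum over finite subfamilies, also when it diverges.\<close>

definition carleson_packing :: "(real ^ 'n) set set \<Rightarrow> (real ^ 'n) set set \<Rightarrow> bool" where
  "carleson_packing D S \<longleftrightarrow> S \<subseteq> D \<and>
     (\<exists>\<xi>::real. 0 < \<xi> \<and>
       (\<forall>R\<in>D. (\<Sum>\<^sub>\<infinity>Q\<in>{Q \<in> S. Q \<subseteq> R}. emeasure lebesgue Q) \<le> ennreal \<xi> * emeasure lebesgue R))"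

definition free_cube :: "(real ^ 'n) set set \<Rightarrow> (real ^ 'n) set \<Rightarrow> (real ^ 'n) set \<Rightarrow> bool" where
  "free_cube D E Q \<longleftrightarrow> Q \<in> D \<and> Q \<inter> E = {}"

definition porous :: "(real ^ 'n) set set \<Rightarrow> (real ^ 'n) set \<Rightarrow> bool" where
  "porous D E \<longleftrightarrow> E \<noteq> {} \<and>
     (\<exists>\<eta>::real. 1 < \<eta> \<and>
       (\<forall>R\<in>D. \<exists>M. free_cube D E M \<and> M \<subseteq> R \<and> \<eta> * measure lebesgue M \<ge> measure lebesgue R))"

text \<open>The cubes \<open>M Q\<close> are arbitrary half-open cubes; they need not belong to \<open>D\<close>.\<close>

definition well_sparse :: "(real ^ 'n) set set \<Rightarrow> (real ^ 'n) set set \<Rightarrow> (real ^ 'n) set \<Rightarrow> bool" where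
  "well_sparse D S E \<longleftrightarrow> S \<subseteq> D \<and>
     (\<exists>(c::real) M. 1 < c \<and>
       (\<forall>Q\<in>S. is_cube (M Q) \<and> M Q \<subseteq> Q) \<and>
       (\<forall>Q'\<in>S. \<forall>Q''\<in>S. Q' \<noteq> Q'' \<longrightarrow> M Q' \<inter> M Q'' = {}) \<and>
       (\<forall>Q\<in>S. c * measure lebesgue (M Q) \<ge> measure lebesgue Q \<and> M Q \<inter> E = {}))"

lemma hcube_eq_iff:
  fixes a b :: "real ^ 'n"
  assumes "0 < l" "0 < m"
  shows "hcube a l = hcube b m \<longleftrightarrow> a = b \<and> l = m"
proof
  assume eq: "hcube a l = hcube b m"
  have "a \<in> hcube a l" "b \<in> hcube b m" using assms by (auto simp: hcube_def)
  then have "a \<in> hcube b m" "b \<in> hcube a l" using eq by auto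
  then have ab: "a = b" by (auto simp: hcube_def vec_eq_iff intro: antisym)
  have mem: "(\<chi> i. a $ i + t) \<in> hcube a r \<longleftrightarrow> 0 \<le> t \<and> t < r" for t r
    by (auto simp: hcube_def)
  have "l = m"
  proof (rule ccontr)
    assume "l \<noteq> m"
    then consider "l < m" | "m < l" by linarith
    then show False
      using mem[of l l] mem[of l m] mem[of m l] mem[of m m] assms
      unfolding eq[unfolded ab] ab by cases simp_all
  qed
  with ab show "a = b \<and> l = m" by simp
qed auto

lemma side_hcube: "0 < l \<Longrightarrow> side (hcube a l) = l"
  unfolding side_def by (rule the_equality) (auto simp: hcube_eq_iff)

lemma dyadic_gen_hcube:
  assumes "0 < l"
  shows "dyadic_gen j (hcube a l) =
    (\<lambda>k. hcube (\<chi> i. a $ i + real (k i) * (l / 2 ^ j)) (l / 2 ^ j)) ` {k. \<forall>i. k i < 2 ^ j}"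
  using assms unfolding dyadic_gen_def by (auto simp: hcube_eq_iff)

lemma side_dyadic_gen:
  assumes "Q \<in> dyadic_gen j R"
  shows "is_cube Q" "side Q = side R / 2 ^ j"
proof -
  obtain a l and k :: "'a \<Rightarrow> nat" where l: "0 < l" and R: "R = hcube a l"
    and Q: "Q = hcube (\<chi> i. a $ i + real (k i) * (l / 2 ^ j)) (l / 2 ^ j)"
    using assms unfolding dyadic_gen_def by blast
  have l': "0 < l / 2 ^ j" using l by simp
  show "is_cube Q" unfolding is_cube_def Q using l' by blast
  show "side Q = side R / 2 ^ j" unfolding Q R side_hcube[OF l] side_hcube[OF l'] ..
qed

lemma mem_grid_cube:
  assumes "0 < (s::real)"
  shows "x \<in> hcube (\<chi> i. a $ i + real (k i) * s) s \<longleftrightarrow> (\<forall>i. \<lfloor>(x $ i - a $ i) / s\<rfloor> = int (k i))"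
proof -
  have "a $ i + real (k i) * s \<le> x $ i \<and> x $ i < a $ i + real (k i) * s + s \<longleftrightarrow>
      \<lfloor>(x $ i - a $ i) / s\<rfloor> = int (k i)" for i
    unfolding floor_eq_iff pos_le_divide_eq[OF assms] pos_divide_less_eq[OF assms]
    by (simp add: distrib_right) linarith
  then show ?thesis by (simp add: hcube_def)
qed

lemma disjoint_dyadic_gen:
  assumes "is_cube R"
  shows "disjoint (dyadic_gen j R)"
proof -
  obtain a l where l: "0 < l" and R: "R = hcube a l" using assms unfolding is_cube_def by blast
  have l': "0 < l / 2 ^ j" using l by simp
  show ?thesis
    unfolding R dyadic_gen_hcube[OF l] disjoint_def
  proof (clarsimp, rule ccontr)
    fix k k'
    let ?Q = "\<lambda>k. hcube (\<chi> i. a $ i + real (k i) * l / 2 ^ j) (l / 2 ^ j)"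
    assume ne: "?Q k \<noteq> ?Q k'" and "?Q k \<inter> ?Q k' \<noteq> {}"
    then obtain x where "x \<in> ?Q k" "x \<in> ?Q k'" by blast
    then have "\<forall>i. int (k i) = int (k' i)"
      using mem_grid_cube[OF l', of x a k] mem_grid_cube[OF l', of x a k'] by simp
    then have "k = k'" by auto
    with ne show False by simp
  qed
qed

lemma Union_dyadic_gen:
  assumes "is_cube R"
  shows "\<Union> (dyadic_gen j R) = R"
proof -
  obtain a l where l: "0 < l" and R: "R = hcube a l" using assms unfolding is_cube_def by blast
  define s where "s = l / 2 ^ j"
  have s: "0 < s" "l = 2 ^ j * s" using l by (auto simp: s_def)
  have mem: "x \<in> R \<longleftrightarrow> (\<forall>i. 0 \<le> \<lfloor>(x $ i - a $ i) / s\<rfloor> \<and> \<lfloor>(x $ i - a $ i) / s\<rfloor> < 2 ^ j)" for x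
  proof -
    have "a $ i \<le> x $ i \<and> x $ i < a $ i + l \<longleftrightarrow>
        0 \<le> \<lfloor>(x $ i - a $ i) / s\<rfloor> \<and> \<lfloor>(x $ i - a $ i) / s\<rfloor> < 2 ^ j" for i
      unfolding zero_le_floor floor_less_iff pos_le_divide_eq[OF s(1)] pos_divide_less_eq[OF s(1)]
      by (simp add: s(2)) linarith
    then show ?thesis by (simp add: R hcube_def)
  qed
  show ?thesis
  proof (rule set_eqI)
    fix x
    have "x \<in> \<Union> (dyadic_gen j R) \<longleftrightarrow>
        (\<exists>k. (\<forall>i. k i < 2 ^ j) \<and> (\<forall>i. \<lfloor>(x $ i - a $ i) / s\<rfloor> = int (k i)))"
      unfolding R dyadic_gen_hcube[OF l] s_def[symmetric] using mem_grid_cube[OF s(1)] by auto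
    also have "\<dots> \<longleftrightarrow> x \<in> R"
    proof
      assume "x \<in> R"
      then show "\<exists>k. (\<forall>i. k i < 2 ^ j) \<and> (\<forall>i. \<lfloor>(x $ i - a $ i) / s\<rfloor> = int (k i))"
        unfolding mem by (intro exI[of _ "\<lambda>i. nat \<lfloor>(x $ i - a $ i) / s\<rfloor>"]) (auto simp: nat_less_iff)
    qed (auto simp: mem simp del: zero_le_floor)
    finally show "x \<in> \<Union> (dyadic_gen j R) \<longleftrightarrow> x \<in> R" .
  qed
qed

lemma card_dyadic_gen:
  fixes R :: "(real ^ 'n) set"
  assumes "is_cube R"
  shows "card (dyadic_gen j R) = 2 ^ (j * CARD('n))"
proof -
  obtain a l where l: "0 < l" and R: "R = hcube a l" using assms unfolding is_cube_def by blast
  have "card (dyadic_gen j R) = card {k :: 'n \<Rightarrow> nat. \<forall>i. k i < 2 ^ j}"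
    unfolding R dyadic_gen_hcube[OF l]
    by (intro card_image inj_onI) (use l in \<open>auto simp: hcube_eq_iff vec_eq_iff\<close>)
  also have "{k :: 'n \<Rightarrow> nat. \<forall>i. k i < 2 ^ j} = Pi\<^sub>E UNIV (\<lambda>_. {..<2 ^ j})"
    by (auto simp: PiE_UNIV_domain)
  also have "card \<dots> = 2 ^ (j * CARD('n))"
    by (subst card_PiE) (auto simp: power_mult)
  finally show ?thesis .
qed

end

theory Submission imports Defs begin

text \<open>The heart of the matter is that (i) implies (iii); from (iii), disjointness gives (ii).
  Let \<open>E\<close> be porous. Inside the middle half of a free cube of \<open>Q\<close> every point has distance at least
  \<open>side Q / (4 * \<eta>)\<close> from \<open>E\<close>, whereas points of a near cube \<open>Q'\<close> have distance less than
  \<open>(\<gamma> + 1) * side Q'\<close>. So sets chosen there for near cubes whose sides differ by a factor above \<open>2 ^ N\<close>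
  are disjoint if \<open>N\<close> is large. To separate the remaining \<open>N\<close> scales, the chosen cube has side \<open>u / 2 ^ N\<close> and
  corner coordinates that are odd multiples of \<open>u\<close>, where \<open>u\<close> is proportional to \<open>side Q\<close>: the binary
  expansions of its points have the digit 1 at place \<open>u\<close> followed by \<open>N\<close> zeros, and such patterns
  at different places at most \<open>N\<close> apart exclude each other.

  For (ii) implies (i), if no cube of generation at most \<open>N\<close> in \<open>R\<close> is free, then all of them are near cubes and their
  volumes add up to \<open>N + 1\<close> times that of \<open>R\<close>, which contradicts Carleson packing for large \<open>N\<close>.\<close>

section \<open>Measurability and volume of half-open cubes\<close>

lemma hcube_borel [simp]: "hcube a l \<in> sets borel"
proof -
  have "hcube a l = (\<Inter>i. {x. a $ i \<le> x $ i} \<inter> {x. x $ i < a $ i + l})"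
    by (auto simp: hcube_def)
  also have "\<dots> \<in> sets borel"
    using closed_halfspace_component_ge_cart open_halfspace_component_lt_cart
    by (intro sets.countable_INT' sets.Int) (auto simp: borel_closed borel_open)
  finally show ?thesis .
qed

text \<open>The half-open cube lies between the open and the closed box with the same corners, and
  these two have equal volume.\<close>

lemma emeasure_hcube:
  fixes a :: "real ^ 'n"
  assumes "0 \<le> l"
  shows "emeasure lebesgue (hcube a l) = ennreal (l ^ CARD('n))"
proof -
  define b where "b = (\<chi> i. a $ i + l)"
  have ne: "cbox a b \<noteq> {}" using assms by (auto simp: b_def interval_ne_empty_cart)
  have c: "measure lborel (cbox a b) = l ^ CARD('n)"
    using content_cbox_cart[OF ne] by (simp add: b_def)
  have cb: "emeasure lebesgue (cbox a b) = ennreal (l ^ CARD('n))"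
    using c emeasure_eq_ennreal_measure[of lborel "cbox a b"] by (simp add: emeasure_lborel_cbox_eq)
  have bb: "emeasure lebesgue (box a b) = ennreal (l ^ CARD('n))"
    using cb by (simp add: emeasure_lborel_box_eq emeasure_lborel_cbox_eq)
  have "box a b \<subseteq> hcube a l" "hcube a l \<subseteq> cbox a b"
    by (auto simp: hcube_def b_def mem_box_cart less_imp_le)
  then show ?thesis
    using emeasure_mono[of "box a b" "hcube a l" lebesgue]
      emeasure_mono[of "hcube a l" "cbox a b" lebesgue] cb bb by auto
qed

lemma measure_hcube:
  "0 \<le> l \<Longrightarrow> measure lebesgue (hcube (a :: real ^ 'n) l) = l ^ CARD('n)"
  by (rule measure_eq_emeasure_eq_ennreal) (simp, rule emeasure_hcube)

lemma is_cube_cases: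
  assumes "is_cube Q"
  obtains a where "0 < side Q" "Q = hcube a (side Q)"
  using assms side_hcube unfolding is_cube_def by metis

lemma side_pos: "is_cube Q \<Longrightarrow> 0 < side Q"
  by (blast elim: is_cube_cases)

lemma is_cube_sets: "is_cube Q \<Longrightarrow> Q \<in> sets lebesgue"
  by (auto simp: is_cube_def)

lemma emeasure_cube:
  fixes Q :: "(real ^ 'n) set"
  shows "is_cube Q \<Longrightarrow> emeasure lebesgue Q = ennreal (side Q ^ CARD('n))"
  by (metis is_cube_cases emeasure_hcube less_imp_le)

lemma measure_cube:
  fixes Q :: "(real ^ 'n) set"
  shows "is_cube Q \<Longrightarrow> measure lebesgue Q = side Q ^ CARD('n)"
  by (metis is_cube_cases measure_hcube less_imp_le)

section \<open>Maximum norm distance and near cubes\<close>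

lemma infnorm_cart_le_iff:
  fixes x :: "real ^ 'n"
  shows "infnorm x \<le> r \<longleftrightarrow> (\<forall>i. \<bar>x $ i\<bar> \<le> r)"
proof -
  have "bdd_above {\<bar>x $ i\<bar> | i. i \<in> UNIV}"
    unfolding full_SetCompr_eq Setcompr_eq_image by (intro bdd_above_finite) simp
  then show ?thesis unfolding infnorm_cart by (subst cSup_le_iff) auto
qed

text \<open>An infimum lies below \<open>r\<close> exactly when some element does, provided that the
  set is nonempty and bounded below; 0 is a lower bound here.\<close>

lemma linf_dist_less_iff:
  assumes "F \<noteq> {}" "E \<noteq> {}"
  shows "linf_dist F E < r \<longleftrightarrow> (\<exists>x\<in>F. \<exists>y\<in>E. infnorm (x - y) < r)"
proof -
  have "bdd_below {infnorm (x - y) | x y. x \<in> F \<and> y \<in> E}"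
    by (rule bdd_belowI[of _ 0]) (auto simp: infnorm_pos_le)
  then show ?thesis unfolding linf_dist_def using assms by (subst cInf_less_iff) auto
qed

lemma infnorm_hcube_le:
  assumes "x \<in> hcube a l" "y \<in> hcube a l"
  shows "infnorm (x - y) \<le> l"
  unfolding infnorm_cart_le_iff
proof
  fix i
  have "a $ i \<le> x $ i" "x $ i < a $ i + l" "a $ i \<le> y $ i" "y $ i < a $ i + l"
    using assms by (auto simp: hcube_def)
  then show "\<bar>(x - y) $ i\<bar> \<le> l" by simp
qed

text \<open>A common point makes the distance 0. This is how cubes that are not free enter the near
  family.\<close>

lemma near_cubesI:
  assumes "Q \<in> D" "is_cube Q" "Q \<inter> E \<noteq> {}" "0 < \<gamma>"
  shows "Q \<in> near_cubes D \<gamma> E"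
proof -
  obtain x where "x \<in> Q" "x \<in> E" using assms(3) by blast
  moreover have "infnorm (x - x) < \<gamma> * side Q"
    using assms(4) side_pos[OF assms(2)] by (simp add: infnorm_0)
  ultimately have "linf_dist Q E < \<gamma> * side Q"
    by (subst linf_dist_less_iff) blast+
  then show ?thesis using assms by (simp add: near_cubes_def)
qed

text \<open>Some pair of points of \<open>Q\<close> and \<open>E\<close> is closer than
  \<open>\<gamma> * side Q\<close>; moving to an arbitrary \<open>x\<close> in \<open>Q\<close>
  costs at most the diameter \<open>side Q\<close>, whence \<open>\<gamma> + 1\<close>.\<close>

lemma near_cubes_infnorm:
  assumes "Q \<in> near_cubes D \<gamma> E" "is_cube Q" "E \<noteq> {}" "x \<in> Q"
  obtains y where "y \<in> E" "infnorm (x - y) < (\<gamma> + 1) * side Q"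
proof -
  have "linf_dist Q E < \<gamma> * side Q" using assms by (simp add: near_cubes_def)
  then obtain z y where zy: "z \<in> Q" "y \<in> E" "infnorm (z - y) < \<gamma> * side Q"
    using assms by (subst (asm) linf_dist_less_iff) auto
  have "infnorm (x - z) \<le> side Q"
    using assms(2,4) zy(1) infnorm_hcube_le by (metis is_cube_cases)
  then have "infnorm (x - y) < (\<gamma> + 1) * side Q"
    using infnorm_triangle[of "x - z" "z - y"] zy(3) by (simp add: algebra_simps)
  with zy(2) that show ?thesis by blast
qed

section \<open>Scales of meeting lattice cubes and the marks that separate them\<close>

lemma dyadic_lattice_cube: "dyadic_lattice D \<Longrightarrow> Q \<in> D \<Longrightarrow> is_cube Q"
  by (simp add: dyadic_lattice_def)

text \<open>Both cubes belong to generations of a common ancestor. Distinct cubes of one generation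
  are disjoint, so the generations differ, and the exponent is their difference.\<close>

lemma dyadic_lattice_sides:
  assumes D: "dyadic_lattice D" and Q: "Q \<in> D" "Q' \<in> D" and le: "side Q' \<le> side Q"
    and meet: "Q \<inter> Q' \<noteq> {}" and ne: "Q \<noteq> Q'"
  obtains i :: nat where "0 < i" "side Q = 2 ^ i * side Q'"
proof -
  obtain P where P: "P \<in> D" "Q \<in> dyadic_subcubes P" "Q' \<in> dyadic_subcubes P"
    using D Q unfolding dyadic_lattice_def by metis
  then obtain j j' where j: "Q \<in> dyadic_gen j P" and j': "Q' \<in> dyadic_gen j' P"
    by (auto simp: dyadic_subcubes_def)
  have cP: "is_cube P" using D P(1) by (rule dyadic_lattice_cube)
  have "j \<noteq> j'"
    using disjoint_dyadic_gen[OF cP, of j] j j' meet ne by (auto simp: disjoint_def)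
  moreover have "(2::real) ^ j \<le> 2 ^ j'"
    using le side_pos[OF cP] side_dyadic_gen(2)[OF j] side_dyadic_gen(2)[OF j']
    by (simp add: field_simps)
  ultimately have "j < j'" by simp
  moreover have "side Q = 2 ^ (j' - j) * side Q'"
    using \<open>j < j'\<close> side_dyadic_gen(2)[OF j] side_dyadic_gen(2)[OF j']
    by (simp add: power_diff)
  ultimately show ?thesis using that[of "j' - j"] by simp
qed

text \<open>The parity of \<open>\<lfloor>t / u'\<rfloor>\<close> decides. Since
  \<open>i \<le> N\<close>, the first interval has length at most \<open>u'\<close>, so the floor is
  \<open>(2 * p + 1) * 2 ^ i\<close>, which is even by \<open>0 < i\<close>; the second interval
  makes it odd.\<close>

lemma binary_marks_disjoint:
  fixes u u' t :: real and p q :: int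
  assumes u': "0 < u'" and u: "u = 2 ^ i * u'" and i: "0 < i" "i \<le> N"
    and t: "(2 * real_of_int p + 1) * u \<le> t" "t < (2 * real_of_int p + 1) * u + u / 2 ^ N"
    and t': "(2 * real_of_int q + 1) * u' \<le> t" "t < (2 * real_of_int q + 1) * u' + u' / 2 ^ N"
  shows False
proof -
  have "\<lfloor>t / u'\<rfloor> = (2 * p + 1) * 2 ^ i"
  proof (rule floor_unique)
    show "real_of_int ((2 * p + 1) * 2 ^ i) \<le> t / u'"
      using t(1) u' by (simp add: u field_simps)
    have "u / 2 ^ N \<le> u'"
      using i u' by (simp add: u field_simps)
    then have "t < (2 * real_of_int p + 1) * u + u'" using t(2) by linarith
    then show "t / u' < real_of_int ((2 * p + 1) * 2 ^ i) + 1"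
      using u' by (simp add: u field_simps)
  qed
  moreover have "\<lfloor>t / u'\<rfloor> = 2 * q + 1"
  proof (rule floor_unique)
    show "real_of_int (2 * q + 1) \<le> t / u'"
      using t'(1) u' by (simp add: field_simps)
    have "u' / 2 ^ N \<le> u'"
      using u' by (simp add: field_simps)
    then have "t < (2 * real_of_int q + 1) * u' + u'" using t'(2) by linarith
    then show "t / u' < real_of_int (2 * q + 1) + 1"
      using u' by (simp add: field_simps)
  qed
  ultimately show False
    using i(1) by (metis even_mult_iff even_power even_numeral dvd_triv_left even_plus_one_iff)
qed

text \<open>Consecutive odd multiples of \<open>u\<close> are \<open>2 * u\<close> apart, so each
  half-open interval of that length contains one.\<close>

lemma odd_multiple_exists:
  fixes u s :: real
  assumes "0 < u"
  obtains p :: int where "s \<le> (2 * real_of_int p + 1) * u" "(2 * real_of_int p + 1) * u < s + 2 * u"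
proof -
  define p where "p = \<lceil>(s / u - 1) / 2\<rceil>"
  have "(s / u - 1) / 2 \<le> p" "p < (s / u - 1) / 2 + 1"
    unfolding p_def by linarith+
  then show ?thesis using assms that[of p] by (simp add: field_simps)
qed

text \<open>The factor 8 in \<open>u\<close> ensures that the middle half of \<open>M\<close> has
  side at least \<open>4 * u\<close>: a corner less than \<open>2 * u\<close> beyond its lower end
  and a cube of side at most \<open>u\<close> fit inside.\<close>

lemma porous_marked_cube:
  fixes M Q E :: "(real ^ 'n) set"
  assumes M: "is_cube M" "M \<inter> E = {}" "M \<subseteq> Q" and Q: "is_cube Q"
    and \<eta>: "1 < \<eta>" "measure lebesgue Q \<le> \<eta> * measure lebesgue M"
  defines "u \<equiv> side Q / (8 * \<eta>)"
  obtains c where "hcube c (u / 2 ^ N) \<subseteq> M"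
    and "\<And>i. \<exists>p :: int. c $ i = (2 * real_of_int p + 1) * u"
    and "\<And>x y. x \<in> hcube c (u / 2 ^ N) \<Longrightarrow> y \<in> E \<Longrightarrow> side Q / (4 * \<eta>) \<le> infnorm (x - y)"
proof -
  obtain a where m0: "0 < side M" and a: "M = hcube a (side M)" using M(1) by (rule is_cube_cases)
  define m where "m = side M"
  have m: "0 < m" "M = hcube a m" using m0 a by (auto simp: m_def)
  have l: "0 < side Q" using Q by (rule side_pos)
  \<comment> \<open>A volume ratio of at most \<open>\<eta>\<close> also bounds the side ratio by
    \<open>\<eta>\<close>, because \<open>\<eta> \<le> \<eta> ^ CARD('n)\<close>; this avoids
    roots.\<close>
  have lm: "side Q / \<eta> \<le> m"
  proof (rule ccontr)
    assume "\<not> side Q / \<eta> \<le> m"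
    then have "\<eta> * m < side Q" using \<eta> by (simp add: field_simps)
    then have "(\<eta> * m) ^ CARD('n) < side Q ^ CARD('n)"
      using m \<eta> by (intro power_strict_mono) auto
    moreover have "\<eta> * m ^ CARD('n) \<le> (\<eta> * m) ^ CARD('n)"
      using m \<eta> by (simp add: power_mult_distrib self_le_power)
    ultimately show False using \<eta>(2) M(1) Q by (simp add: measure_cube m_def)
  qed
  have u: "0 < u" "8 * u \<le> m" using l lm \<eta> by (auto simp: u_def field_simps)
  have uN: "u / 2 ^ N \<le> u" using u by (simp add: field_simps)
  have "\<exists>p :: int. a $ i + m / 4 \<le> (2 * real_of_int p + 1) * u \<and> (2 * real_of_int p + 1) * u < a $ i + m / 4 + 2 * u" for i
    using odd_multiple_exists[OF u(1)] by metis
  then obtain p :: "'n \<Rightarrow> int" where p: "\<And>i. a $ i + m / 4 \<le> (2 * real_of_int (p i) + 1) * u"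
      "\<And>i. (2 * real_of_int (p i) + 1) * u < a $ i + m / 4 + 2 * u"
    by metis
  define c where "c = (\<chi> i. (2 * real_of_int (p i) + 1) * u)"
  have mid: "a $ i + m / 4 \<le> x $ i \<and> x $ i \<le> a $ i + 3 * m / 4" if "x \<in> hcube c (u / 2 ^ N)" for x i
  proof -
    have "c $ i \<le> x $ i" "x $ i < c $ i + u / 2 ^ N" using that by (auto simp: hcube_def)
    then show ?thesis using p[of i] uN u by (simp add: c_def)
  qed
  show ?thesis
  proof (rule that[of c])
    show "hcube c (u / 2 ^ N) \<subseteq> M"
    proof
      fix x assume "x \<in> hcube c (u / 2 ^ N)"
      then have "a $ i \<le> x $ i \<and> x $ i < a $ i + m" for i
        using mid[of x i] m(1) by linarith
      then show "x \<in> M" by (simp add: m(2) hcube_def)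
    qed
    show "\<exists>p :: int. c $ i = (2 * real_of_int p + 1) * u" for i by (auto simp: c_def)
    show "side Q / (4 * \<eta>) \<le> infnorm (x - y)" if x: "x \<in> hcube c (u / 2 ^ N)" and y: "y \<in> E" for x y
    proof -
      \<comment> \<open>A point outside \<open>M\<close> leaves its range in some coordinate, and
        there the middle half keeps distance \<open>m / 4\<close> from both ends.\<close>
      have "y \<notin> hcube a m" using y M(2) m(2) by blast
      then obtain i where "y $ i < a $ i \<or> a $ i + m \<le> y $ i" by (auto simp: hcube_def not_le not_less)
      then have "m / 4 \<le> \<bar>(x - y) $ i\<bar>" using mid[OF x, of i] by auto
      also have "\<dots> \<le> infnorm (x - y)" by (rule component_le_infnorm_cart)
      finally show ?thesis using lm by (simp add: field_simps)
    qed
  qed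
qed

section \<open>The three implications\<close>

theorem porous_imp_well_sparse:
  fixes D :: "(real ^ 'n) set set"
  assumes D: "dyadic_lattice D" and \<gamma>: "0 < \<gamma>" and porous: "porous D E"
  shows "well_sparse D (near_cubes D \<gamma> E) E"
proof -
  let ?S = "near_cubes D \<gamma> E"
  have S: "?S \<subseteq> D" by (auto simp: near_cubes_def)
  have cube: "is_cube Q" if "Q \<in> ?S" for Q using that S D dyadic_lattice_cube by blast
  obtain \<eta> where E: "E \<noteq> {}" and \<eta>: "1 < \<eta>"
    and free: "\<And>R. R \<in> D \<Longrightarrow> \<exists>M. free_cube D E M \<and> M \<subseteq> R \<and> measure lebesgue R \<le> \<eta> * measure lebesgue M"
    using porous unfolding porous_def by metis
  \<comment> \<open>With this \<open>N\<close>, the margin \<open>side Q / (4 * \<eta>)\<close>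
    exceeds \<open>(\<gamma> + 1) * side Q'\<close> as soon as \<open>side Q\<close> is at least
    \<open>2 ^ N * side Q'\<close>.\<close>
  obtain N :: nat where N: "4 * \<eta> * (\<gamma> + 1) < 2 ^ N"
    using real_arch_pow[of 2 "4 * \<eta> * (\<gamma> + 1)"] by auto
  define u where "u Q = side Q / (8 * \<eta>)" for Q :: "(real ^ 'n) set"
  have "\<exists>c. hcube c (u Q / 2 ^ N) \<subseteq> Q \<and> (\<forall>i. \<exists>p :: int. c $ i = (2 * real_of_int p + 1) * u Q) \<and>
      (\<forall>x\<in>hcube c (u Q / 2 ^ N). \<forall>y\<in>E. side Q / (4 * \<eta>) \<le> infnorm (x - y))" if Q: "Q \<in> ?S" for Q
  proof -
    obtain M where "free_cube D E M" "M \<subseteq> Q" "measure lebesgue Q \<le> \<eta> * measure lebesgue M"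
      using free Q S by blast
    then show ?thesis
      using porous_marked_cube[of M E Q \<eta> N] \<eta> cube[OF Q] dyadic_lattice_cube[OF D]
      unfolding free_cube_def u_def by (metis order_trans)
  qed
  then obtain c where c: "\<And>Q. Q \<in> ?S \<Longrightarrow> hcube (c Q) (u Q / 2 ^ N) \<subseteq> Q"
    and mark: "\<And>Q i. Q \<in> ?S \<Longrightarrow> \<exists>p :: int. c Q $ i = (2 * real_of_int p + 1) * u Q"
    and far: "\<And>Q x y. Q \<in> ?S \<Longrightarrow> x \<in> hcube (c Q) (u Q / 2 ^ N) \<Longrightarrow> y \<in> E \<Longrightarrow>
      side Q / (4 * \<eta>) \<le> infnorm (x - y)"
    by metis
  define M where "M Q = hcube (c Q) (u Q / 2 ^ N)" for Q
  have u: "0 < u Q" if "Q \<in> ?S" for Q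
    using side_pos[OF cube[OF that]] \<eta> by (simp add: u_def)
  have disj: "M Q \<inter> M Q' = {}"
    if Q: "Q \<in> ?S" "Q' \<in> ?S" and ne: "Q \<noteq> Q'" and le: "side Q' \<le> side Q" for Q Q'
  proof (rule ccontr)
    assume "M Q \<inter> M Q' \<noteq> {}"
    then obtain x where x: "x \<in> M Q" "x \<in> M Q'" by blast
    then have xQ: "x \<in> Q" "x \<in> Q'" using c Q unfolding M_def by blast+
    then obtain i where i: "0 < i" "side Q = 2 ^ i * side Q'"
      using dyadic_lattice_sides[OF D _ _ le _ ne] Q S by blast
    have ui: "u Q = 2 ^ i * u Q'" by (simp add: u_def i(2))
    have l': "0 < side Q'" using cube Q(2) side_pos by blast
    show False
    proof (cases "i \<le> N")
      case True
      \<comment> \<open>The marks already exclude each other in a single coordinate, and any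
        \<open>k\<close> will do.\<close>
      fix k :: 'n
      obtain p q :: int where "c Q $ k = (2 * real_of_int p + 1) * u Q" "c Q' $ k = (2 * real_of_int q + 1) * u Q'"
        using mark Q by metis
      moreover have "c Q $ k \<le> x $ k" "x $ k < c Q $ k + u Q / 2 ^ N"
          "c Q' $ k \<le> x $ k" "x $ k < c Q' $ k + u Q' / 2 ^ N"
        using x by (auto simp: M_def hcube_def)
      ultimately show False
        using binary_marks_disjoint[OF u[OF Q(2)] ui i(1) True, of p "x $ k" q] by simp
    next
      case False
      \<comment> \<open>As a point of the near cube \<open>Q'\<close>, \<open>x\<close> is closer to
        \<open>E\<close> than the margin that \<open>M Q\<close> guarantees.\<close>
      obtain y where y: "y \<in> E" "infnorm (x - y) < (\<gamma> + 1) * side Q'"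
        using near_cubes_infnorm[OF Q(2) cube[OF Q(2)] E xQ(2)] by blast
      have "2 ^ i * side Q' / (4 * \<eta>) < (\<gamma> + 1) * side Q'"
        using far[OF Q(1) _ y(1)] x(1) y(2) i(2) by (force simp: M_def)
      then have "2 ^ i * side Q' < (4 * \<eta> * (\<gamma> + 1)) * side Q'" using \<eta> by (simp add: field_simps)
      then have "2 ^ i < 4 * \<eta> * (\<gamma> + 1)" using l' by (rule mult_right_less_imp_less[OF _ less_imp_le])
      moreover have "(2::real) ^ N \<le> 2 ^ i" using False by simp
      ultimately show False using N by linarith
    qed
  qed
  show ?thesis
    unfolding well_sparse_def
  \<comment> \<open>The side of \<open>M Q\<close> is \<open>side Q / (8 * \<eta> * 2 ^ N)\<close>,
    which dictates the constant.\<close>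
  proof (intro conjI S exI[of _ "(8 * \<eta> * 2 ^ N) ^ CARD('n)"] exI[of _ M] ballI impI)
    have "1 < 8 * \<eta> * 2 ^ N"
      using \<eta> one_le_power[of "2::real" N] mult_mono[of 1 \<eta> 1 "2 ^ N"] by simp
    then show "1 < (8 * \<eta> * 2 ^ N) ^ CARD('n)" by (simp add: one_less_power)
    show "M Q \<inter> M Q' = {}" if "Q \<in> ?S" "Q' \<in> ?S" "Q \<noteq> Q'" for Q Q'
      using disj[of Q Q'] disj[of Q' Q] that by (cases "side Q' \<le> side Q") auto
    fix Q assume Q: "Q \<in> ?S"
    show "is_cube (M Q)" unfolding M_def is_cube_def
      using u[OF Q] by (intro exI[of _ "c Q"] exI[of _ "u Q / 2 ^ N"]) simp
    show "M Q \<subseteq> Q" using c Q by (simp add: M_def)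
    show "measure lebesgue Q \<le> (8 * \<eta> * 2 ^ N) ^ CARD('n) * measure lebesgue (M Q)"
    proof -
      have "measure lebesgue (M Q) = (u Q / 2 ^ N) ^ CARD('n)"
        unfolding M_def using u[OF Q] by (intro measure_hcube) simp
      moreover have "8 * \<eta> * 2 ^ N * (u Q / 2 ^ N) = side Q" using \<eta> by (simp add: u_def)
      ultimately show ?thesis
        unfolding measure_cube[OF cube[OF Q]] by (metis order_refl power_mult_distrib)
    qed
    show "M Q \<inter> E = {}"
    proof (rule ccontr)
      assume "M Q \<inter> E \<noteq> {}"
      then obtain x where "x \<in> M Q" "x \<in> E" by blast
      with far[OF Q, of x x] side_pos[OF cube[OF Q]] \<eta> show False
        by (simp add: M_def infnorm_0 divide_le_0_iff)
    qed
  qed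
qed

text \<open>The cubes \<open>M Q\<close> with \<open>Q \<subseteq> R\<close> are disjoint parts of
  \<open>R\<close>, each carrying at least the share \<open>1 / c\<close> of the volume of its
  \<open>Q\<close>, so \<open>c\<close> itself serves as packing constant.\<close>

theorem well_sparse_imp_carleson_packing:
  fixes D :: "(real ^ 'n) set set"
  assumes D: "dyadic_lattice D" and ws: "well_sparse D S E"
  shows "carleson_packing D S"
proof -
  obtain c :: real and M where S: "S \<subseteq> D" and c: "1 < c"
    and *: "\<forall>Q\<in>S. is_cube (M Q) \<and> M Q \<subseteq> Q"
      "\<forall>Q'\<in>S. \<forall>Q''\<in>S. Q' \<noteq> Q'' \<longrightarrow> M Q' \<inter> M Q'' = {}"
      "\<forall>Q\<in>S. c * measure lebesgue (M Q) \<ge> measure lebesgue Q \<and> M Q \<inter> E = {}"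
    using ws unfolding well_sparse_def by (elim conjE exE)
  have cube: "\<And>Q. Q \<in> S \<Longrightarrow> is_cube (M Q)" and sub: "\<And>Q. Q \<in> S \<Longrightarrow> M Q \<subseteq> Q"
    and disj: "\<And>Q Q'. Q \<in> S \<Longrightarrow> Q' \<in> S \<Longrightarrow> Q \<noteq> Q' \<Longrightarrow> M Q \<inter> M Q' = {}"
    and big: "\<And>Q. Q \<in> S \<Longrightarrow> measure lebesgue Q \<le> c * measure lebesgue (M Q)"
    using * by auto
  have cD: "is_cube Q" if "Q \<in> D" for Q using D that by (rule dyadic_lattice_cube)
  have "(\<Sum>\<^sub>\<infinity>Q\<in>{Q \<in> S. Q \<subseteq> R}. emeasure lebesgue Q) \<le> ennreal c * emeasure lebesgue R" if R: "R \<in> D" for R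
  \<comment> \<open>Bounding all finite partial sums suffices, so only finite additivity is
    needed.\<close>
  proof (rule infsum_le_finite_sums)
    fix F assume F: "finite F" "F \<subseteq> {Q \<in> S. Q \<subseteq> R}"
    have "(\<Sum>Q\<in>F. emeasure lebesgue Q) \<le> (\<Sum>Q\<in>F. ennreal c * emeasure lebesgue (M Q))"
    proof (rule sum_mono)
      fix Q assume "Q \<in> F"
      then have "Q \<in> S" "is_cube Q" using F S cD by auto
      then show "emeasure lebesgue Q \<le> ennreal c * emeasure lebesgue (M Q)"
        using big[of Q] cube[of Q] c side_pos[of "M Q"]
        by (simp add: emeasure_cube measure_cube ennreal_leI flip: ennreal_mult)
    qed
    also have "\<dots> = ennreal c * (\<Sum>Q\<in>F. emeasure lebesgue (M Q))"
      by (simp add: sum_distrib_left)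
    also have "\<dots> = ennreal c * emeasure lebesgue (\<Union>Q\<in>F. M Q)"
    proof (rule arg_cong[OF sum_emeasure])
      show "M ` F \<subseteq> sets lebesgue" using F cube is_cube_sets by blast
      show "disjoint_family_on M F" unfolding disjoint_family_on_def using F disj by blast
    qed (rule F)
    also have "\<dots> \<le> ennreal c * emeasure lebesgue R"
      using F sub is_cube_sets[OF cD[OF R]] by (intro mult_left_mono emeasure_mono) auto
    finally show "(\<Sum>Q\<in>F. emeasure lebesgue Q) \<le> ennreal c * emeasure lebesgue R" .
  qed (simp add: nonneg_summable_on_complete)
  then show ?thesis unfolding carleson_packing_def using S c by (intro conjI exI[of _ c]) auto
qed

theorem carleson_packing_imp_porous:
  fixes D :: "(real ^ 'n) set set"
  assumes D: "dyadic_lattice D" and E: "E \<noteq> {}" and \<gamma>: "0 < \<gamma>"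
    and carleson: "carleson_packing D (near_cubes D \<gamma> E)"
  shows "porous D E"
proof -
  obtain \<xi> where \<xi>: "0 < \<xi>" and pack: "\<And>R. R \<in> D \<Longrightarrow>
      (\<Sum>\<^sub>\<infinity>Q\<in>{Q \<in> near_cubes D \<gamma> E. Q \<subseteq> R}. emeasure lebesgue Q) \<le> ennreal \<xi> * emeasure lebesgue R"
    using carleson unfolding carleson_packing_def by blast
  \<comment> \<open>Each of the generations 0 to \<open>N\<close> contributes the full volume of
    \<open>R\<close>, and \<open>N + 1\<close> such copies exceed the packing bound.\<close>
  obtain N :: nat where N: "\<xi> < N" using reals_Archimedean2 by blast
  have free_gen: "\<exists>j\<le>N. \<exists>Q\<in>dyadic_gen j R. Q \<inter> E = {}" if R: "R \<in> D" for R
  proof (rule ccontr)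
    assume "\<not> ?thesis"
    then have meet: "Q \<inter> E \<noteq> {}" if "j \<le> N" "Q \<in> dyadic_gen j R" for j Q using that by blast
    have cR: "is_cube R" using D R by (rule dyadic_lattice_cube)
    have l: "0 < side R" using cR by (rule side_pos)
    let ?F = "\<Union>j\<in>{..N}. dyadic_gen j R"
    have fin: "finite (dyadic_gen j R)" for j
      using card_dyadic_gen[OF cR, of j] by (intro card_ge_0_finite) simp
    have gen: "(\<Sum>Q\<in>dyadic_gen j R. emeasure lebesgue Q) = emeasure lebesgue R" for j
    proof -
      have "disjoint_family_on (\<lambda>Q. Q) (dyadic_gen j R)"
        using disjoint_dyadic_gen[OF cR, of j] by (auto simp: disjoint_def disjoint_family_on_def)
      then have "(\<Sum>Q\<in>dyadic_gen j R. emeasure lebesgue Q) = emeasure lebesgue (\<Union>Q\<in>dyadic_gen j R. Q)"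
        using side_dyadic_gen(1) is_cube_sets fin by (intro sum_emeasure) blast+
      then show ?thesis using Union_dyadic_gen[OF cR] by simp
    qed
    have "of_nat (Suc N) * emeasure lebesgue R = (\<Sum>j\<le>N. \<Sum>Q\<in>dyadic_gen j R. emeasure lebesgue Q)"
      by (simp add: gen)
    also have "\<dots> = (\<Sum>Q\<in>?F. emeasure lebesgue Q)"
    proof (rule sum.UNION_disjoint[symmetric])
      \<comment> \<open>Different generations have different sides, so no cube is counted
        twice.\<close>
      have "i = j" if "Q \<in> dyadic_gen i R" "Q \<in> dyadic_gen j R" for Q i j
        using side_dyadic_gen(2)[OF that(1)] side_dyadic_gen(2)[OF that(2)] l by simp
      then show "\<forall>i\<in>{..N}. \<forall>j\<in>{..N}. i \<noteq> j \<longrightarrow> dyadic_gen i R \<inter> dyadic_gen j R = {}" by blast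
    qed (use fin in auto)
    also have "\<dots> = infsum (emeasure lebesgue) ?F" using fin by simp
    also have "\<dots> \<le> (\<Sum>\<^sub>\<infinity>Q\<in>{Q \<in> near_cubes D \<gamma> E. Q \<subseteq> R}. emeasure lebesgue Q)"
    proof (rule infsum_mono_neutral)
      fix Q assume "Q \<in> ?F - {Q \<in> near_cubes D \<gamma> E. Q \<subseteq> R}"
      moreover have "Q \<in> near_cubes D \<gamma> E \<and> Q \<subseteq> R" if "j \<le> N" "Q \<in> dyadic_gen j R" for j
      proof
        have "Q \<in> D" using D R that(2) unfolding dyadic_lattice_def dyadic_subcubes_def by blast
        then show "Q \<in> near_cubes D \<gamma> E"
          using side_dyadic_gen(1)[OF that(2)] meet[OF that] \<gamma> by (rule near_cubesI)
        show "Q \<subseteq> R" using Union_dyadic_gen[OF cR] that(2) by blast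
      qed
      ultimately show "emeasure lebesgue Q \<le> 0" by blast
    qed (auto intro: nonneg_summable_on_complete)
    also have "\<dots> \<le> ennreal \<xi> * emeasure lebesgue R" using R by (rule pack)
    finally have "ennreal (real (Suc N) * side R ^ CARD('n)) \<le> ennreal (\<xi> * side R ^ CARD('n))"
      using \<xi> l by (simp only: emeasure_cube[OF cR] ennreal_mult ennreal_of_nat_eq_real_of_nat
          less_imp_le zero_le_power of_nat_0_le_iff)
    then have "real (Suc N) * side R ^ CARD('n) \<le> \<xi> * side R ^ CARD('n)"
      using \<xi> l by (subst (asm) ennreal_le_iff) auto
    then show False using N l by simp
  qed
  \<comment> \<open>A free cube of generation at most \<open>N\<close> has side at least
    \<open>side R / 2 ^ N\<close>; the exponent \<open>Suc N\<close> makes it immediate that the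
    porosity constant exceeds 1.\<close>
  have free: "\<exists>M. free_cube D E M \<and> M \<subseteq> R \<and>
      measure lebesgue R \<le> (2 ^ Suc N) ^ CARD('n) * measure lebesgue M"
    if R: "R \<in> D" for R
  proof -
    obtain j Q where j: "j \<le> N" "Q \<in> dyadic_gen j R" "Q \<inter> E = {}"
      using free_gen[OF R] by blast
    have cR: "is_cube R" using D R by (rule dyadic_lattice_cube)
    have "Q \<in> D" using D R j(2) unfolding dyadic_lattice_def dyadic_subcubes_def by blast
    moreover have "Q \<subseteq> R" using Union_dyadic_gen[OF cR] j(2) by blast
    moreover have "side R \<le> 2 ^ Suc N * side Q"
    proof -
      have "side R = 2 ^ j * side Q" using side_dyadic_gen(2)[OF j(2)] by simp
      also have "\<dots> \<le> 2 ^ Suc N * side Q"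
        using j(1) side_pos[OF side_dyadic_gen(1)[OF j(2)]]
        by (intro mult_right_mono power_increasing) auto
      finally show ?thesis .
    qed
    then have "side R ^ CARD('n) \<le> (2 ^ Suc N * side Q) ^ CARD('n)"
      using side_pos[OF cR] by (intro power_mono) auto
    ultimately show ?thesis
      using j(3) measure_cube[OF cR] measure_cube[OF side_dyadic_gen(1)[OF j(2)]]
      by (metis free_cube_def power_mult_distrib)
  qed
  have "1 < ((2::real) ^ Suc N) ^ CARD('n)" by (intro one_less_power) auto
  then show ?thesis unfolding porous_def using E free by blast
qed

theorem theorem5:
  fixes D :: "(real ^ 'n) set set" and E :: "(real ^ 'n) set" and \<gamma> :: real
  assumes "dyadic_lattice D" and "E \<noteq> {}" and "0 < \<gamma>"
  shows "(porous D E \<longleftrightarrow> carleson_packing D (near_cubes D \<gamma> E)) \<and>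
         (carleson_packing D (near_cubes D \<gamma> E) \<longleftrightarrow> well_sparse D (near_cubes D \<gamma> E) E)"
  using porous_imp_well_sparse[OF assms(1,3)] well_sparse_imp_carleson_packing[OF assms(1)]
    carleson_packing_imp_porous[OF assms]
  by blast

end
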